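(* The sequence $\alpha_{10},\alpha_{11},\alpha_{12},\dots$ converges $10$-adically; that is, for every positive integer $j$ there is $N$ such that $\alpha_n\equiv\alpha_{N}\pmod{10^j}$ for all $n\ge N$.
   Context: For a positive integer $a$ with decimal expansion $a=\sum_{i=0}^{k} c_i 10^i$, $c_i\in\{0,\dots,9\}$, $c_k\neq 0$, and an integer $b\ge 10$, let $a\_b:=\sum_{i=0}^{k} c_i b^i$ (the decimal digit string of $a$ interpreted in base $b$). Define $\alpha_{10}=10$ and, for $n\ge 11$, $\alpha_n = 10\_(11\_(12\_(\cdots\_((n-1)\_n)\cdots)))$. *)

theory Defs
  imports "HOL-Number_Theory.Cong" "HOL-Library.Log_Nat"
begin

text \<open>
  For \<open>a > 0\<close>, \<open>floorlog 10 a\<close> is the number \<open>k + 1\<close> of decimal digits of \<open>a\<close>, and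
  \<open>a div 10 ^ i mod 10\<close> is the digit \<open>c\<^sub>i\<close>; see \<open>rebase_eq\<close> below.
\<close>

definition rebase :: "nat \<Rightarrow> nat \<Rightarrow> nat" where
  "rebase a b = (\<Sum>i<floorlog 10 a. (a div 10 ^ i mod 10) * b ^ i)"

text \<open>
  The nesting is to the right: \<open>alpha n = rebase 10 (rebase 11 (\<dots> (rebase (n - 1) n)))\<close>.
  Only the values for \<open>n \<ge> 10\<close> are meaningful.
\<close>

definition alpha :: "nat \<Rightarrow> nat" where
  "alpha n = foldr rebase [10..<n] n"

lemma decimal_less:
  fixes c :: "nat \<Rightarrow> nat"
  assumes "\<And>i. i < m \<Longrightarrow> c i < 10"
  shows "(\<Sum>i<m. c i * 10 ^ i) < 10 ^ m"
  using assms
proof (induction m)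
  case (Suc m)
  have "c m * 10 ^ m \<le> 9 * 10 ^ m" using Suc.prems[of m] by simp
  moreover have "(\<Sum>i<m. c i * 10 ^ i) < 10 ^ m" using Suc by simp
  ultimately show ?case unfolding sum.lessThan_Suc power_Suc by linarith
qed simp

lemma decimal_digit:
  fixes c :: "nat \<Rightarrow> nat"
  assumes "\<And>i. i < m \<Longrightarrow> c i < 10" and "j < m"
  shows "(\<Sum>i<m. c i * 10 ^ i) div 10 ^ j mod 10 = c j"
  using assms
proof (induction m arbitrary: c j)
  case (Suc m)
  have eq: "(\<Sum>i<Suc m. c i * 10 ^ i) = c 0 + 10 * (\<Sum>i<m. c (Suc i) * 10 ^ i)"
    unfolding sum.lessThan_Suc_shift by (simp add: sum_distrib_left mult_ac)
  show ?case
  proof (cases j)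
    case 0
    then show ?thesis unfolding eq using Suc.prems(1)[of 0] by simp
  next
    case (Suc k)
    have "(c 0 + 10 * S) div 10 ^ Suc k = S div 10 ^ k" for S
      using Suc.prems(1)[of 0] by (simp add: div_mult2_eq)
    then show ?thesis
      unfolding eq Suc using Suc.IH[of "\<lambda>i. c (Suc i)" k] Suc.prems \<open>j = Suc k\<close> by simp
  qed
qed simp

lemma rebase_eq:
  fixes c :: "nat \<Rightarrow> nat"
  assumes "a = (\<Sum>i\<le>k. c i * 10 ^ i)" and "\<And>i. i \<le> k \<Longrightarrow> c i \<le> 9" and "c k \<noteq> 0"
  shows "rebase a b = (\<Sum>i\<le>k. c i * b ^ i)"
proof -
  have a: "a = (\<Sum>i<Suc k. c i * 10 ^ i)" using assms(1) by (simp add: lessThan_Suc_atMost)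
  have c: "c i < 10" if "i < Suc k" for i using assms(2)[of i] that by simp
  have ub: "a < 10 ^ Suc k" unfolding a by (rule decimal_less) (rule c)
  have "10 ^ k \<le> c k * 10 ^ k" using assms(3) by simp
  also have "\<dots> \<le> a" unfolding a by simp
  finally have "floorlog 10 a = Suc k"
    using ub by (intro antisym floorlog_leI floorlog_ge_SucI) simp_all
  then show ?thesis
    unfolding rebase_def a lessThan_Suc_atMost[symmetric]
    by (intro sum.cong) (simp_all only: decimal_digit[OF c] lessThan_iff)
qed

lemma alpha_10: "alpha 10 = 10"
  by (simp add: alpha_def)

lemma alpha_12: "alpha 12 = rebase 10 (rebase 11 12)"
  by (simp add: alpha_def upt_conv_Cons)

end

theory Submission
  imports Defs
begin

text \<open>
  For fixed \<open>a\<close>, \<open>b \<mapsto> rebase a b\<close> is a polynomial with natural coefficients, so it preserves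
  congruences modulo any \<open>m\<close>. For \<open>a = d * 10 ^ k\<close> with a digit \<open>d\<close> it is \<open>d * b ^ k\<close>, which even
  improves a congruence modulo \<open>m\<close> to one modulo \<open>d * m\<close>. Between \<open>10 ^ k\<close> and \<open>10 ^ Suc k\<close> the
  sequence passes through both \<open>2 * 10 ^ k\<close> and \<open>5 * 10 ^ k\<close>, so each such block gains a factor 10
  in the modulus, and the innermost argument becomes irrelevant modulo \<open>10 ^ j\<close> after \<open>j\<close> blocks.
\<close>

lemma rebase_cong:
  assumes "[x = y] (mod m)"
  shows "[rebase a x = rebase a y] (mod m)"
  unfolding rebase_def using assms by (intro cong_sum cong_mult cong_pow cong_refl)

lemma foldr_rebase_cong:
  assumes "[x = y] (mod m)"
  shows "[foldr rebase as x = foldr rebase as y] (mod m)"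
  using assms by (induction "as") (simp_all add: rebase_cong)

lemma rebase_single_digit:
  assumes "0 < d" "d < 10"
  shows "rebase (d * 10 ^ k) b = d * b ^ k"
proof -
  define c where "c i = (if i = k then d else 0)" for i
  have sum: "(\<Sum>i\<le>k. c i * x ^ i) = d * x ^ k" for x :: nat
    by (simp add: c_def if_distrib[of "\<lambda>t. t * _"] cong: if_cong)
  have "rebase (d * 10 ^ k) b = (\<Sum>i\<le>k. c i * b ^ i)"
    using assms by (intro rebase_eq) (simp_all add: sum, simp_all add: c_def)
  then show ?thesis by (simp only: sum)
qed

lemma foldr_rebase_upt_cong_digit:
  assumes "[x = y] (mod m)" "0 < d" "d < 10" "l \<le> d * 10 ^ k" "d * 10 ^ k < u"
  shows "[foldr rebase [l..<u] x = foldr rebase [l..<u] y] (mod d * m)"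
proof -
  let ?c = "d * 10 ^ k"
  have split: "[l..<u] = [l..<?c] @ ?c # [Suc ?c..<u]"
    using assms(4,5) upt_add_eq_append[of l ?c "u - ?c"] by (simp add: upt_conv_Cons)
  \<comment> \<open>Entries after \<open>?c\<close> act first and keep the modulus \<open>m\<close>;
    the factor \<open>d\<close> at \<open>?c\<close> then scales it.\<close>
  have "[d * foldr rebase [Suc ?c..<u] x ^ k = d * foldr rebase [Suc ?c..<u] y ^ k] (mod d * m)"
    using assms(1,2) by (intro cong_cmult_leftI cong_pow foldr_rebase_cong)
  then show ?thesis
    unfolding split using assms(2,3) by (simp add: rebase_single_digit foldr_rebase_cong)
qed

lemma foldr_rebase_decade_cong:
  assumes "[x = y] (mod m)"
  shows "[foldr rebase [10 ^ k..<10 ^ Suc k] x = foldr rebase [10 ^ k..<10 ^ Suc k] y] (mod 10 * m)"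
proof -
  \<comment> \<open>The cut at \<open>3 * 10 ^ k\<close> separates the two gains: the factor 5 comes
    first, then 2.\<close>
  have split: "[10 ^ k..<10 ^ Suc k] = [10 ^ k..<3 * 10 ^ k] @ [3 * 10 ^ k..<10 ^ Suc k :: nat]"
    using upt_add_eq_append[of "10 ^ k" "3 * 10 ^ k" "7 * 10 ^ k"] by simp
  have "[foldr rebase [3 * 10 ^ k..<10 ^ Suc k] x = foldr rebase [3 * 10 ^ k..<10 ^ Suc k] y]
      (mod 5 * m)"
    using assms by (rule foldr_rebase_upt_cong_digit[where k = k]) simp_all
  then have "[foldr rebase [10 ^ k..<10 ^ Suc k] x = foldr rebase [10 ^ k..<10 ^ Suc k] y]
      (mod 2 * (5 * m))"
    unfolding split foldr_append o_apply
    by (rule foldr_rebase_upt_cong_digit[where k = k]) simp_all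
  then show ?thesis by simp
qed

lemma foldr_rebase_contracting:
  assumes "[x = y] (mod m)"
  shows "[foldr rebase [10..<10 ^ Suc j] x = foldr rebase [10..<10 ^ Suc j] y] (mod 10 ^ j * m)"
  using assms
proof (induction j arbitrary: x y m)
  case (Suc j)
  have "(10::nat) * 1 \<le> 10 * 10 ^ j" by (intro mult_le_mono2) simp
  then have "[10..<10 ^ Suc (Suc j)] = [10..<10 ^ Suc j] @ [10 ^ Suc j..<10 ^ Suc (Suc j) :: nat]"
    using upt_add_eq_append[of 10 "10 ^ Suc j" "9 * 10 ^ Suc j"] by simp
  \<comment> \<open>The last block acts first, so its outputs enter the induction hypothesis with
    modulus \<open>10 * m\<close>.\<close>
  then show ?case
    using Suc.IH[OF foldr_rebase_decade_cong[OF Suc.prems, of "Suc j"]] by (simp add: mult_ac)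
qed simp

theorem theorem4:
  "\<forall>j\<ge>1. \<exists>N\<ge>10. \<forall>n\<ge>N. [alpha n = alpha N] (mod 10 ^ j)"
proof (intro allI impI)
  fix j :: nat
  let ?N = "10 ^ Suc j :: nat"
  have N: "10 \<le> ?N" by simp
  have "[alpha n = alpha ?N] (mod 10 ^ j)" if "?N \<le> n" for n
  proof -
    have "[10..<n] = [10..<?N] @ [?N..<n]"
      using N that upt_add_eq_append[of 10 ?N "n - ?N"] by simp
    \<comment> \<open>Modulo 1 the value of the tail and \<open>?N\<close> are trivially congruent,
      so the whole modulus comes from the blocks.\<close>
    then show ?thesis
      using foldr_rebase_contracting[of "foldr rebase [?N..<n] n" ?N 1 j] by (simp add: alpha_def)
  qed
  then show "\<exists>N\<ge>10. \<forall>n\<ge>N. [alpha n = alpha N] (mod 10 ^ j)"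
    using N by blast
qed

end
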